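(* Fix $x>0$. Let $T_1$ be a rooted tree with root $v_1$ and branches $L_1,\dots,L_{d_1}$, let $T_2$ be a rooted tree with root $v_2$ and branches $R_1,\dots,R_{d_2}$, and let $T_0$ be a tree with two distinct vertices $u,v$. Let $T$ be the tree obtained from $T_1,T_2,T_0$ by identifying $v_1$ with $u$ and $v_2$ with $v$. Let $d\ge\max\{d_1,d_2\}$ be a positive integer. If $d_1+d_2>d$, rearrange $L_1,\dots,L_{d_1},R_1,\dots,R_{d_2}$ as $L'_1,\dots,L'_{d_1+d_2-d},R'_1,\dots,R'_d$ so that $$\tau(S(L'_1),x)\ge\dots\ge\tau(S(L'_{d_1+d_2-d}),x)\ge\tau(S(R'_1),x)\ge\dots\ge\tau(S(R'_d),x),$$ and let $T'_1$ be the rooted tree with root $v_1$ and branches $L'_1,\dots,L'_{d_1+d_2-d}$ and $T'_2$ the rooted tree with root $v_2$ and branches $R'_1,\dots,R'_d$. If $d_1+d_2\le d$, let $T'_1$ be the single vertex $v_1$ and $T'_2$ the rooted tree with root $v_2$ and branches $R'_1,\dots,R'_{d_1+d_2}$, a rearrangement of $L_1,\dots,L_{d_1},R_1,\dots,R_{d_2}$. Let $T'$ be the tree obtained from $T'_1,T'_2,T_0$ by identifying $v_1$ with $u$ and $v_2$ with $v$. If $M_{10}(S(T_0),x)\le M_{01}(S(T_0),x)$, then $$M(S(T),x)\ge M(S(T'),x).$$ Moreover, equality holds if and only if either $d_2=d$ and $\max\{\tau(S(R_j),x):1\le j\le d_2\}\le\min\{\tau(S(L_j),x):1\le j\le d_1\}$,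 or $M_{10}(S(T_0),x)=M_{01}(S(T_0),x)$, $d_1=d$ and $\max\{\tau(S(L_j),x):1\le j\le d_1\}\le\min\{\tau(S(R_j),x):1\le j\le d_2\}$.
   Context: For a rooted tree with root $w$, its branches are the connected components of the tree minus $w$, each rooted at its unique vertex adjacent to $w$. The subdivision tree $S(T)$ of a tree $T$ is obtained by inserting a new vertex into every edge of $T$; rooted trees keep their root. For a tree $T$, $m(T,k)$ is the number of matchings with exactly $k$ edges ($m(T,0)=1$) and $M(T,x)=\sum_{k\ge0}m(T,k)x^k$. For a rooted tree, $m_0(T,k)$ counts $k$-matchings not saturating the root, $M_0(T,x)=\sum_k m_0(T,k)x^k$, and $\tau(T,x)=M_0(T,x)/M(T,x)$. For the tree $T_0$ with vertices $u,v$, $M_{10}(S(T_0),x)$ (resp. $M_{01}(S(T_0),x)$) is $\sum_k a_kx^k$ where $a_k$ is the number of $k$-matchings of $S(T_0)$ that saturate $u$ but not $v$ (resp. saturate $v$ but not $u$).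
   Formalization: The equality criterion is asserted only if d_1,d_2≥1 or d_1+d_2≥d, with max≤min read as true for an empty list; for d_1=0, 1≤d_2<d one has T'=T, so equality holds though neither condition does. The inequality is for all d_1,d_2≥0. *)

theory Defs
  imports Complex_Main "HOL-Library.Multiset"
begin

section \<open>Finite simple graphs and trees\<close>

text \<open>A graph is a pair of a vertex set and a set of edges, each edge being a two-element set of
  vertices.  A rooted graph is a graph together with a vertex.\<close>

type_synonym 'a ugraph = "'a set \<times> 'a set set"
type_synonym 'a rooted_ugraph = "'a ugraph \<times> 'a"

abbreviation verts :: "'a ugraph \<Rightarrow> 'a set" where "verts \<equiv> fst"
abbreviation edges :: "'a ugraph \<Rightarrow> 'a set set" where "edges \<equiv> snd"

definition is_ugraph :: "'a ugraph \<Rightarrow> bool" where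
  "is_ugraph G \<longleftrightarrow> finite (verts G) \<and> (\<forall>e\<in>edges G. e \<subseteq> verts G \<and> card e = 2)"

definition adj :: "'a ugraph \<Rightarrow> ('a \<times> 'a) set" where
  "adj G = {(a, b). {a, b} \<in> edges G}"

definition connected_ugraph :: "'a ugraph \<Rightarrow> bool" where
  "connected_ugraph G \<longleftrightarrow>
     verts G \<noteq> {} \<and> (\<forall>a\<in>verts G. \<forall>b\<in>verts G. (a, b) \<in> (adj G)\<^sup>*)"

definition is_cycle :: "'a ugraph \<Rightarrow> 'a list \<Rightarrow> bool" where
  "is_cycle G c \<longleftrightarrow> length c \<ge> 3 \<and> distinct c \<and>
     (\<forall>i<length c. {c ! i, c ! (Suc i mod length c)} \<in> edges G)"

definition is_tree :: "'a ugraph \<Rightarrow> bool" where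
  "is_tree G \<longleftrightarrow> is_ugraph G \<and> connected_ugraph G \<and> (\<nexists>c. is_cycle G c)"

definition is_rooted_tree :: "'a ugraph \<Rightarrow> 'a \<Rightarrow> bool" where
  "is_rooted_tree T w \<longleftrightarrow> is_tree T \<and> w \<in> verts T"

section \<open>Branches of a rooted tree\<close>

definition induced :: "'a ugraph \<Rightarrow> 'a set \<Rightarrow> 'a ugraph" where
  "induced G W = (verts G \<inter> W, {e \<in> edges G. e \<subseteq> W})"

definition delete_vertex :: "'a ugraph \<Rightarrow> 'a \<Rightarrow> 'a ugraph" where
  "delete_vertex G w = induced G (verts G - {w})"

definition components :: "'a ugraph \<Rightarrow> 'a ugraph set" where
  "components G = (\<lambda>a. induced G {b \<in> verts G. (a, b) \<in> (adj G)\<^sup>*}) ` verts G"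

definition branches :: "'a ugraph \<Rightarrow> 'a \<Rightarrow> 'a rooted_ugraph set" where
  "branches T w =
     (\<lambda>C. (C, THE r. r \<in> verts C \<and> {w, r} \<in> edges T)) ` components (delete_vertex T w)"

definition has_branches :: "'a ugraph \<Rightarrow> 'a \<Rightarrow> 'a rooted_ugraph list \<Rightarrow> bool" where
  "has_branches T w Bs \<longleftrightarrow> is_rooted_tree T w \<and> distinct Bs \<and> set Bs = branches T w"

section \<open>Subdivision and identification of vertices\<close>

text \<open>The vertex inserted into the edge \<open>e\<close> is \<open>Inr e\<close>; an old vertex \<open>a\<close> becomes \<open>Inl a\<close>.\<close>

definition subdivision :: "'a ugraph \<Rightarrow> ('a + 'a set) ugraph" where
  "subdivision G =
     (Inl ` verts G \<union> Inr ` edges G, {{Inl a, Inr e} | a e. e \<in> edges G \<and> a \<in> e})"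

definition rooted_subdivision :: "'a rooted_ugraph \<Rightarrow> ('a + 'a set) rooted_ugraph" where
  "rooted_subdivision B = (subdivision (fst B), Inl (snd B))"

definition map_ugraph :: "('a \<Rightarrow> 'b) \<Rightarrow> 'a ugraph \<Rightarrow> 'b ugraph" where
  "map_ugraph f G = (f ` verts G, (\<lambda>e. f ` e) ` edges G)"

definition union_ugraph :: "'a ugraph \<Rightarrow> 'a ugraph \<Rightarrow> 'a ugraph" where
  "union_ugraph G H = (verts G \<union> verts H, edges G \<union> edges H)"

definition identify :: "'a \<Rightarrow> 'a \<Rightarrow> 'a ugraph \<Rightarrow> 'a ugraph" where
  "identify w u G = map_ugraph (\<lambda>y. if y = w then u else y) G"

text \<open>Meant for \<open>T0\<close>, \<open>T1\<close>, \<open>T2\<close> with pairwise disjoint vertex sets.\<close>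

definition attach :: "'a ugraph \<Rightarrow> 'a \<Rightarrow> 'a \<Rightarrow> 'a ugraph \<Rightarrow> 'a \<Rightarrow> 'a ugraph \<Rightarrow> 'a \<Rightarrow> 'a ugraph" where
  "attach T0 u v T1 v1 T2 v2 =
     identify v1 u (identify v2 v (union_ugraph T0 (union_ugraph T1 T2)))"

section \<open>Matching polynomials\<close>

definition is_matching :: "'a ugraph \<Rightarrow> 'a set set \<Rightarrow> bool" where
  "is_matching G N \<longleftrightarrow> N \<subseteq> edges G \<and> (\<forall>e\<in>N. \<forall>f\<in>N. e \<noteq> f \<longrightarrow> e \<inter> f = {})"

definition saturates :: "'a set set \<Rightarrow> 'a \<Rightarrow> bool" where
  "saturates N a \<longleftrightarrow> (\<exists>e\<in>N. a \<in> e)"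

definition match_count :: "'a ugraph \<Rightarrow> nat \<Rightarrow> nat" where
  "match_count G k = card {N. is_matching G N \<and> card N = k}"

definition match_count_0 :: "'a ugraph \<Rightarrow> 'a \<Rightarrow> nat \<Rightarrow> nat" where
  "match_count_0 G w k = card {N. is_matching G N \<and> card N = k \<and> \<not> saturates N w}"

definition match_count_10 :: "'a ugraph \<Rightarrow> 'a \<Rightarrow> 'a \<Rightarrow> nat \<Rightarrow> nat" where
  "match_count_10 G u v k = card {N. is_matching G N \<and> card N = k \<and> saturates N u \<and> \<not> saturates N v}"

definition match_count_01 :: "'a ugraph \<Rightarrow> 'a \<Rightarrow> 'a \<Rightarrow> nat \<Rightarrow> nat" where
  "match_count_01 G u v k = card {N. is_matching G N \<and> card N = k \<and> saturates N v \<and> \<not> saturates N u}"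

text \<open>No matching has more than \<open>card (edges G)\<close> edges, so truncating the sums there drops only
  zero terms.\<close>

definition match_poly :: "'a ugraph \<Rightarrow> real \<Rightarrow> real" where
  "match_poly G x = (\<Sum>k\<le>card (edges G). real (match_count G k) * x ^ k)"

definition match_poly_0 :: "'a ugraph \<Rightarrow> 'a \<Rightarrow> real \<Rightarrow> real" where
  "match_poly_0 G w x = (\<Sum>k\<le>card (edges G). real (match_count_0 G w k) * x ^ k)"

definition match_poly_10 :: "'a ugraph \<Rightarrow> 'a \<Rightarrow> 'a \<Rightarrow> real \<Rightarrow> real" where
  "match_poly_10 G u v x = (\<Sum>k\<le>card (edges G). real (match_count_10 G u v k) * x ^ k)"

definition match_poly_01 :: "'a ugraph \<Rightarrow> 'a \<Rightarrow> 'a \<Rightarrow> real \<Rightarrow> real" where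
  "match_poly_01 G u v x = (\<Sum>k\<le>card (edges G). real (match_count_01 G u v k) * x ^ k)"

definition tau :: "'a rooted_ugraph \<Rightarrow> real \<Rightarrow> real" where
  "tau B x = match_poly_0 (fst B) (snd B) x / match_poly (fst B) x"

text \<open>The comparison \<open>max A \<le> min B\<close> for finite sets, vacuously true if one of them is empty
  (where \<open>Max\<close> and \<open>Min\<close> are unspecified).\<close>

definition max_le_min :: "real set \<Rightarrow> real set \<Rightarrow> bool" where
  "max_le_min A B \<longleftrightarrow> A = {} \<or> B = {} \<or> Max A \<le> Min B"

end

theory Submission
  imports Defs "HOL-Library.Disjoint_Sets"
begin

text \<open>A branch \<open>L\<close>, joined to \<open>w\<close> through the inserted vertex, contributes to the matching
  sum of the subdivision a factor \<open>p = M(S(L)) + x M\<^sub>0(S(L))\<close> if the edge at \<open>w\<close> is unused, and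
  \<open>x M(S(L)) = a p\<close> with \<open>a = x / (1 + x \<tau>(S(L)))\<close> if it is used.  With \<open>A\<close> and \<open>B\<close> the sums of \<open>a\<close> over
  the branches at \<open>u\<close> and at \<open>v\<close>, the polynomial of \<open>S(T)\<close> is therefore a constant multiple of
  \<open>m\<^sub>0\<^sub>0 (1 + A) (1 + B) + m\<^sub>1\<^sub>0 (1 + B) + m\<^sub>0\<^sub>1 (1 + A) + m\<^sub>1\<^sub>1\<close>, and \<open>A + B\<close> does not depend on the
  distribution of the branches.  Replacing \<open>A\<close> by \<open>A'\<close> lowers it by
  \<open>(A - A') (m\<^sub>0\<^sub>0 (B - A') + m\<^sub>0\<^sub>1 - m\<^sub>1\<^sub>0)\<close>.  Since large \<open>\<tau>\<close> means small \<open>a\<close>, \<open>A'\<close> is the sum of the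
  smallest \<open>d\<^sub>1 + d\<^sub>2 - d\<close> of the numbers \<open>a\<close>, hence at most \<open>A\<close> and at most \<open>B\<close>.\<close>

section \<open>Weighted sums over matchings\<close>

text \<open>Edge sets replace graphs from here on: deleting a vertex becomes filtering and gluing
  becomes union, without bookkeeping of isolated vertices.\<close>

definition matchings :: "'b set set \<Rightarrow> 'b set set set" where
  "matchings E = {N. N \<subseteq> E \<and> disjoint N}"

text \<open>The matching polynomial evaluated at \<open>x\<close>, summed over matchings rather than
  over their sizes.\<close>

definition mpoly :: "real \<Rightarrow> 'b set set \<Rightarrow> real" where
  "mpoly x E = (\<Sum>N\<in>matchings E. x ^ card N)"

definition avoiding :: "'b \<Rightarrow> 'b set set \<Rightarrow> 'b set set" where
  "avoiding a E = {e \<in> E. a \<notin> e}"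

lemma finite_matchings [simp]: "finite E \<Longrightarrow> finite (matchings E)"
  by (rule finite_subset[of _ "Pow E"]) (auto simp: matchings_def)

lemma finite_avoiding [simp]: "finite E \<Longrightarrow> finite (avoiding a E)"
  by (simp add: avoiding_def)

lemma avoiding_Un: "avoiding a (E \<union> F) = avoiding a E \<union> avoiding a F"
  by (auto simp: avoiding_def)

lemma avoiding_commute: "avoiding a (avoiding b E) = avoiding b (avoiding a E)"
  by (auto simp: avoiding_def)

lemma avoiding_trivial: "a \<notin> \<Union>E \<Longrightarrow> avoiding a E = E"
  by (auto simp: avoiding_def)

lemma Union_avoiding: "\<Union>(avoiding a E) \<subseteq> \<Union>E"
  by (auto simp: avoiding_def)

lemma empty_in_avoiding: "{} \<notin> E \<Longrightarrow> {} \<notin> avoiding a E"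
  by (auto simp: avoiding_def)

lemma mpoly_pos:
  assumes "finite E" "x > 0" shows "mpoly x E > 0"
proof -
  have "{} \<in> matchings E" by (simp add: matchings_def)
  then show ?thesis
    unfolding mpoly_def using assms by (intro sum_pos) auto
qed

text \<open>Restricting a matching to \<open>E\<close> and to \<open>F\<close> is inverse to taking
  the union. \<open>{} \<notin> E\<close> excludes the one set that could lie in both although no
  vertex does.\<close>

lemma mpoly_Un:
  assumes "finite E" "finite F" "\<Union>E \<inter> \<Union>F = {}" "{} \<notin> E"
  shows "mpoly x (E \<union> F) = mpoly x E * mpoly x F"
proof -
  have EF: "E \<inter> F = {}"
  proof (rule equals0I)
    fix e assume e: "e \<in> E \<inter> F"
    then have "e \<subseteq> \<Union>E \<inter> \<Union>F" by blast
    then show False using assms(3,4) e by auto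
  qed
  have "mpoly x E * mpoly x F =
      (\<Sum>(N, N')\<in>matchings E \<times> matchings F. x ^ card N * x ^ card N')"
    by (simp add: mpoly_def sum_product sum.cartesian_product)
  also have "\<dots> = (\<Sum>N\<in>matchings (E \<union> F). x ^ card N)"
  proof (rule sum.reindex_bij_witness[of _ "\<lambda>N. (N \<inter> E, N \<inter> F)" "\<lambda>(N, N'). N \<union> N'"])
    fix p assume "p \<in> matchings E \<times> matchings F"
    then obtain N N' where p: "p = (N, N')" "N \<subseteq> E" "disjoint N" "N' \<subseteq> F" "disjoint N'"
      by (auto simp: matchings_def)
    show "(\<lambda>N. (N \<inter> E, N \<inter> F)) ((\<lambda>(N, N'). N \<union> N') p) = p" using p EF by auto
    show "(\<lambda>(N, N'). N \<union> N') p \<in> matchings (E \<union> F)"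
    proof -
      have "\<Union>N \<inter> \<Union>N' \<subseteq> \<Union>E \<inter> \<Union>F" using p(2,4) by (intro Int_mono Union_mono)
      then have "disjoint (N \<union> N')" using p(3,5) assms(3) by (intro disjoint_union) simp_all
      then show ?thesis using p(1,2,4) by (auto simp: matchings_def)
    qed
    have "card (N \<union> N') = card N + card N'"
      using p EF assms(1,2) by (intro card_Un_disjoint) (auto intro: finite_subset)
    then show "x ^ card ((\<lambda>(N, N'). N \<union> N') p) = (\<lambda>(N, N'). x ^ card N * x ^ card N') p"
      by (simp add: p power_add)
  next
    fix N assume "N \<in> matchings (E \<union> F)"
    then have N: "N \<subseteq> E \<union> F" "disjoint N" by (auto simp: matchings_def)
    have "disjoint (N \<inter> E)" "disjoint (N \<inter> F)" using N(2) by (auto intro: pairwise_subset)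
    then show "(\<lambda>N. (N \<inter> E, N \<inter> F)) N \<in> matchings E \<times> matchings F"
      by (simp add: matchings_def)
    show "(\<lambda>(N, N'). N \<union> N') ((\<lambda>N. (N \<inter> E, N \<inter> F)) N) = N"
      using N(1) by auto
  qed
  finally show ?thesis by (simp add: mpoly_def)
qed

text \<open>Edge recurrence: a matching either omits \<open>e\<close> or consists of
  \<open>e\<close> and a matching of the edges disjoint from it.\<close>

lemma mpoly_insert:
  assumes "finite E" "e \<notin> E" "e \<noteq> {}"
  shows "mpoly x (insert e E) = mpoly x E + x * mpoly x {f \<in> E. f \<inter> e = {}}"
proof -
  let ?D = "matchings {f \<in> E. f \<inter> e = {}}"
  have *: "matchings (insert e E) = matchings E \<union> insert e ` ?D"
  proof (intro equalityI subsetI)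
    fix N assume N: "N \<in> matchings (insert e E)"
    show "N \<in> matchings E \<union> insert e ` ?D"
    proof (cases "e \<in> N")
      case True
      have "N - {e} \<in> ?D" using N True by (auto simp: matchings_def disjoint_def)
      moreover have "N = insert e (N - {e})" using True by auto
      ultimately show ?thesis by blast
    next
      case False then show ?thesis using N by (auto simp: matchings_def)
    qed
  next
    fix N assume "N \<in> matchings E \<union> insert e ` ?D"
    then show "N \<in> matchings (insert e E)"
      by (fastforce simp: matchings_def disjoint_def)
  qed
  have fin: "finite N" "e \<notin> N" if "N \<in> ?D" for N
    using that assms by (auto simp: matchings_def intro: finite_subset)
  have inj: "inj_on (insert e) ?D"
    using fin(2) by (intro inj_onI) (metis insert_ident)
  have "mpoly x (insert e E) = mpoly x E + (\<Sum>N\<in>insert e ` ?D. x ^ card N)"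
    unfolding mpoly_def * using assms
    by (intro sum.union_disjoint) (auto simp: matchings_def)
  also have "(\<Sum>N\<in>insert e ` ?D. x ^ card N) = x * mpoly x {f \<in> E. f \<inter> e = {}}"
    unfolding mpoly_def sum_distrib_left sum.reindex[OF inj]
    by (intro sum.cong) (auto simp: fin)
  finally show ?thesis .
qed

lemma mpoly_pendant:
  assumes "finite G" "m \<notin> \<Union>G"
  shows "mpoly x (insert {r, m} G) = mpoly x G + x * mpoly x (avoiding r G)"
proof -
  have "{f \<in> G. f \<inter> {r, m} = {}} = avoiding r G" using assms(2) by (auto simp: avoiding_def)
  moreover have "{r, m} \<notin> G" using assms(2) by blast
  ultimately show ?thesis using mpoly_insert[OF assms(1), of "{r, m}" x] by (simp only: insert_not_empty not_False_eq_True simp_thms)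
qed

lemma mpoly_hang_Un:
  assumes "finite F" "finite G" "{} \<notin> F" "\<Union>F \<inter> insert r (insert m (\<Union>G)) = {}" "m \<notin> \<Union>G"
  shows "mpoly x (F \<union> insert {r, m} G) = mpoly x F * (mpoly x G + x * mpoly x (avoiding r G))"
proof -
  have "\<Union>F \<inter> \<Union>(insert {r, m} G) = {}" using assms(4) by simp
  then show ?thesis using assms by (subst mpoly_Un) (simp_all add: mpoly_pendant)
qed

text \<open>The path \<open>w\<close>, \<open>m\<close>, \<open>r\<close> joins \<open>F\<close> to
  \<open>G\<close>. Using \<open>{w, m}\<close> excludes \<open>{r, m}\<close> and all edges of
  \<open>F\<close> at \<open>w\<close>, but leaves \<open>G\<close> unrestricted.\<close>

lemma mpoly_hang:
  assumes "finite F" "finite G" "{} \<notin> F" "\<Union>F \<inter> insert r (insert m (\<Union>G)) = {}"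
    and "m \<notin> \<Union>G" "w \<noteq> r" "w \<noteq> m" "w \<notin> \<Union>G"
  shows "mpoly x (F \<union> insert {w, m} (insert {r, m} G)) =
    mpoly x F * (mpoly x G + x * mpoly x (avoiding r G)) + x * mpoly x (avoiding w F) * mpoly x G"
proof -
  let ?H = "F \<union> insert {r, m} G"
  have "{f \<in> ?H. f \<inter> {w, m} = {}} = avoiding w F \<union> G"
  proof -
    have "m \<notin> \<Union>F" using assms(4) by fastforce
    then have "f \<inter> {w, m} = {} \<longleftrightarrow> w \<notin> f" if "f \<in> F" for f using that by auto
    moreover have "f \<inter> {w, m} = {}" if "f \<in> G" for f using that assms(5,8) by auto
    moreover have "{r, m} \<inter> {w, m} \<noteq> {}" by auto
    ultimately show ?thesis unfolding avoiding_def by auto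
  qed
  moreover have "mpoly x (avoiding w F \<union> G) = mpoly x (avoiding w F) * mpoly x G"
  proof (rule mpoly_Un)
    show "\<Union>(avoiding w F) \<inter> \<Union>G = {}" using assms(4) Union_avoiding[of w F] by fastforce
  qed (use assms in \<open>simp_all add: empty_in_avoiding\<close>)
  moreover have "{w, m} \<notin> ?H"
  proof -
    have "m \<notin> \<Union>F" using assms(4) by fastforce
    then have "{w, m} \<notin> F" "{w, m} \<notin> G" using assms(5) by (metis UnionI insertI1 insertI2)+
    then show ?thesis using assms(6,7) by (auto simp: doubleton_eq_iff)
  qed
  ultimately have "mpoly x (insert {w, m} ?H) =
      mpoly x ?H + x * (mpoly x (avoiding w F) * mpoly x G)"
    using assms(1,2) by (simp add: mpoly_insert)
  then show ?thesis using mpoly_hang_Un[OF assms(1-5)] by (simp add: algebra_simps)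
qed

section \<open>Matching polynomials as weighted sums over matchings\<close>

lemma sum_card_fibres:
  fixes x :: real
  assumes "finite A" "\<And>N. N \<in> A \<Longrightarrow> card N \<le> n"
  shows "(\<Sum>k\<le>n. real (card {N \<in> A. card N = k}) * x ^ k) = (\<Sum>N\<in>A. x ^ card N)"
proof -
  have "(\<Sum>N\<in>A. x ^ card N) = (\<Sum>k\<le>n. \<Sum>N\<in>{N \<in> A. card N = k}. x ^ card N)"
    using assms by (intro sum.group[symmetric]) auto
  then show ?thesis by simp
qed

lemma is_matching_iff: "is_matching G N \<longleftrightarrow> N \<in> matchings (edges G)"
  by (auto simp: is_matching_def matchings_def disjoint_def)

text \<open>\<open>P\<close> stands for a saturation condition, so that one computation serves
  \<open>match_poly\<close>, \<open>match_poly_0\<close> and \<open>match_poly_10\<close>.\<close>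

lemma matching_filter_sum:
  fixes x :: real
  assumes "finite (edges G)"
  shows "(\<Sum>k\<le>card (edges G). real (card {N. is_matching G N \<and> card N = k \<and> P N}) * x ^ k) =
    (\<Sum>N\<in>{N \<in> matchings (edges G). P N}. x ^ card N)"
proof -
  have "{N. is_matching G N \<and> card N = k \<and> P N} = {N \<in> {N \<in> matchings (edges G). P N}. card N = k}" for k
    by (auto simp: is_matching_iff)
  then show ?thesis
    by (simp only:) (rule sum_card_fibres, use assms in \<open>auto simp: matchings_def card_mono\<close>)
qed

lemma match_poly_eq:
  "finite (edges G) \<Longrightarrow> match_poly G x = mpoly x (edges G)"
  using matching_filter_sum[of G "\<lambda>_. True" x]
  by (simp add: match_poly_def match_count_def mpoly_def)

lemma matchings_avoiding: "matchings (avoiding a E) = {N \<in> matchings E. \<not> saturates N a}"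
  by (auto simp: matchings_def avoiding_def saturates_def)

lemma match_poly_0_eq:
  "finite (edges G) \<Longrightarrow> match_poly_0 G a x = mpoly x (avoiding a (edges G))"
  using matching_filter_sum[of G "\<lambda>N. \<not> saturates N a" x]
  by (simp add: match_poly_0_def match_count_0_def mpoly_def matchings_avoiding)

text \<open>Among the matchings that avoid \<open>b\<close>, those saturating \<open>a\<close>
  remain after subtracting those that avoid \<open>a\<close> too. This ties the hypothesis of the
  theorem to sums over vertex-deleted edge sets.\<close>

lemma match_poly_10_eq:
  assumes "finite (edges G)"
  shows "match_poly_10 G a b x =
    mpoly x (avoiding b (edges G)) - mpoly x (avoiding a (avoiding b (edges G)))"
proof -
  let ?M = "matchings (edges G)"
  have "match_poly_10 G a b x = (\<Sum>N\<in>{N \<in> ?M. saturates N a \<and> \<not> saturates N b}. x ^ card N)"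
    using matching_filter_sum[OF assms, of "\<lambda>N. saturates N a \<and> \<not> saturates N b" x]
    by (simp add: match_poly_10_def match_count_10_def)
  also have "{N \<in> ?M. saturates N a \<and> \<not> saturates N b} =
      matchings (avoiding b (edges G)) - matchings (avoiding a (avoiding b (edges G)))"
    by (auto simp: matchings_avoiding)
  finally show ?thesis
    using assms by (simp add: mpoly_def sum_diff matchings_avoiding Collect_mono)
qed

lemma match_poly_01_eq_10: "match_poly_01 G a b x = match_poly_10 G b a x"
  by (simp add: match_poly_01_def match_poly_10_def match_count_01_def match_count_10_def)

section \<open>Hanging rooted graphs at a vertex of a subdivided graph\<close>

text \<open>A function of the edge set alone, hence compatible with unions; branches can thus be
  split off one at a time.\<close>

definition subdivided :: "'a set set \<Rightarrow> ('a + 'a set) set set" where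
  "subdivided E = {{Inl a, Inr e} | a e. e \<in> E \<and> a \<in> e}"

lemma edges_subdivision: "edges (subdivision G) = subdivided (edges G)"
  by (simp add: subdivision_def subdivided_def)

lemma subdivided_Un: "subdivided (E \<union> F) = subdivided E \<union> subdivided F"
  by (auto simp: subdivided_def)

lemma subdivided_insert_pair:
  "subdivided (insert {w, r} E) =
     insert {Inl w, Inr {w, r}} (insert {Inl r, Inr {w, r}} (subdivided E))"
  by (auto simp: subdivided_def)

lemma empty_notin_subdivided [simp]: "{} \<notin> subdivided E"
  by (auto simp: subdivided_def)

lemma Inl_in_subdivided: "Inl a \<in> \<Union>(subdivided E) \<longleftrightarrow> a \<in> \<Union>E"
  by (auto simp: subdivided_def)

lemma Inr_in_subdivided: "Inr e \<in> \<Union>(subdivided E) \<longleftrightarrow> e \<in> E \<and> e \<noteq> {}"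
  by (auto simp: subdivided_def)

lemma finite_subdivided:
  assumes "finite E" "\<And>e. e \<in> E \<Longrightarrow> finite e"
  shows "finite (subdivided E)"
proof -
  have "subdivided E = (\<Union>e\<in>E. (\<lambda>a. {Inl a, Inr e}) ` e)" by (auto simp: subdivided_def)
  then show ?thesis using assms by simp
qed

text \<open>Avoiding \<open>shadow W\<close> rather than \<open>Inl ` W\<close> also excludes the vertices inserted into edges that are
  still to be hung.\<close>

definition shadow :: "'a set \<Rightarrow> ('a + 'a set) set" where
  "shadow W = Inl ` W \<union> Inr ` {e. e \<inter> W \<noteq> {}}"

lemma subdivided_shadow_disjoint:
  "\<Union>E \<inter> W = {} \<Longrightarrow> \<Union>(subdivided E) \<inter> shadow W = {}"
  by (fastforce simp: subdivided_def shadow_def)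

lemma shadow_mono: "U \<subseteq> W \<Longrightarrow> shadow U \<subseteq> shadow W"
  by (auto simp: shadow_def)

text \<open>Isolates what the counting takes from a set of branches. Acyclicity and connectedness of
  the rooted trees enter only in \<open>has_branches_decompose\<close>, which establishes this
  property.\<close>

definition rooted_family :: "'a rooted_ugraph set \<Rightarrow> bool" where
  "rooted_family \<B> \<longleftrightarrow> finite \<B> \<and>
     (\<forall>B\<in>\<B>. finite (verts (fst B)) \<and> (\<forall>e\<in>edges (fst B). e \<subseteq> verts (fst B)) \<and>
        snd B \<in> verts (fst B)) \<and>
     (\<forall>B\<in>\<B>. \<forall>C\<in>\<B>. B \<noteq> C \<longrightarrow> verts (fst B) \<inter> verts (fst C) = {})"

definition family_verts :: "'a rooted_ugraph set \<Rightarrow> 'a set" where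
  "family_verts \<B> = (\<Union>B\<in>\<B>. verts (fst B))"

text \<open>For the branches of a tree rooted at \<open>w\<close> this is the edge set of the tree.
  With \<open>w\<close> as a parameter, identifying the root with \<open>u\<close> or
  \<open>v\<close> only changes that parameter.\<close>

definition hang :: "'a \<Rightarrow> 'a rooted_ugraph set \<Rightarrow> 'a set set" where
  "hang w \<B> = (\<Union>B\<in>\<B>. insert {w, snd B} (edges (fst B)))"

text \<open>These are the numbers \<open>p\<close> and \<open>a\<close> of the introduction.\<close>

definition branch_weight :: "real \<Rightarrow> 'a rooted_ugraph \<Rightarrow> real" where
  "branch_weight x B = match_poly (subdivision (fst B)) x +
     x * match_poly_0 (subdivision (fst B)) (Inl (snd B)) x"

definition branch_share :: "real \<Rightarrow> 'a rooted_ugraph \<Rightarrow> real" where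
  "branch_share x B = x * match_poly (subdivision (fst B)) x / branch_weight x B"

lemma hang_insert: "hang w (insert B \<B>) = insert {w, snd B} (edges (fst B)) \<union> hang w \<B>"
  by (auto simp: hang_def)

lemma mem_hangI: "B \<in> \<B> \<Longrightarrow> e = {w, snd B} \<or> e \<in> edges (fst B) \<Longrightarrow> e \<in> hang w \<B>"
  by (auto simp: hang_def)

lemma rooted_family_disjoint:
  "rooted_family \<B> \<Longrightarrow> B \<in> \<B> \<Longrightarrow> C \<in> \<B> \<Longrightarrow> B \<noteq> C \<Longrightarrow> verts (fst B) \<inter> verts (fst C) = {}"
  by (simp add: rooted_family_def)

lemma Union_hang_subset:
  "rooted_family \<B> \<Longrightarrow> \<Union>(hang w \<B>) \<subseteq> insert w (family_verts \<B>)"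
  by (fastforce simp: rooted_family_def hang_def family_verts_def)

lemma rooted_family_subset: "rooted_family \<B> \<Longrightarrow> \<A> \<subseteq> \<B> \<Longrightarrow> rooted_family \<A>"
  unfolding rooted_family_def by (meson finite_subset subset_iff)

lemma finite_edges_bounded:
  assumes "finite V" "\<forall>e\<in>E. e \<subseteq> V"
  shows "finite E" "finite (subdivided E)"
proof -
  show "finite E" using assms by (intro finite_subset[of E "Pow V"]) auto
  then show "finite (subdivided E)" using assms by (intro finite_subdivided) (auto intro: finite_subset)
qed

lemma finite_subdivided_hang:
  assumes "rooted_family \<B>"
  shows "finite (subdivided (hang w \<B>))"
proof -
  have "\<forall>e\<in>hang w \<B>. e \<subseteq> insert w (family_verts \<B>)" using Union_hang_subset[OF assms] by blast
  moreover have "finite (insert w (family_verts \<B>))"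
    using assms by (auto simp: rooted_family_def family_verts_def)
  ultimately show ?thesis by (metis finite_edges_bounded(2))
qed

text \<open>Dividing numerator and denominator of the share by \<open>mpoly x G\<close> expresses it
  through \<tau>. This is the link between the order of the \<tau>-values and the sums to be
  compared.\<close>

lemma branch_facts:
  assumes "rooted_family \<B>" "B \<in> \<B>" "x > 0"
  defines "G \<equiv> subdivided (edges (fst B))"
  shows "finite G" "branch_weight x B = mpoly x G + x * mpoly x (avoiding (Inl (snd B)) G)"
    and "branch_weight x B > 0" "branch_weight x B * branch_share x B = x * mpoly x G"
    and "tau (rooted_subdivision B) x > 0"
    and "branch_share x B = x / (1 + x * tau (rooted_subdivision B) x)"
proof -
  show fin: "finite G"
    using assms(1,2) unfolding G_def rooted_family_def by (meson finite_edges_bounded(2))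
  have M: "match_poly (subdivision (fst B)) x = mpoly x G"
    "match_poly_0 (subdivision (fst B)) (Inl (snd B)) x = mpoly x (avoiding (Inl (snd B)) G)"
    using fin by (simp_all add: match_poly_eq match_poly_0_eq edges_subdivision G_def)
  have pos: "mpoly x G > 0" "mpoly x (avoiding (Inl (snd B)) G) > 0"
    using assms(3) by (auto intro!: mpoly_pos simp: fin)
  show W: "branch_weight x B = mpoly x G + x * mpoly x (avoiding (Inl (snd B)) G)"
    by (simp add: branch_weight_def M)
  show "branch_weight x B > 0" unfolding W using pos assms(3) by (simp add: add_pos_pos)
  then show "branch_weight x B * branch_share x B = x * mpoly x G"
    by (simp add: branch_share_def M)
  have tau: "tau (rooted_subdivision B) x = mpoly x (avoiding (Inl (snd B)) G) / mpoly x G"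
    by (simp add: tau_def rooted_subdivision_def M)
  show "tau (rooted_subdivision B) x > 0" using pos by (simp add: tau)
  have "mpoly x G + x * mpoly x (avoiding (Inl (snd B)) G) > 0"
    using pos assms(3) by (simp add: add_pos_pos)
  then show "branch_share x B = x / (1 + x * tau (rooted_subdivision B) x)"
    using pos unfolding branch_share_def tau W M by (simp add: field_simps)
qed

text \<open>Of the branch and its joining edge, only one half edge contains
  \<open>Inl w\<close>.\<close>

lemma avoiding_hanging_branch:
  assumes "rooted_family {B}" "w \<notin> verts (fst B)"
  shows "avoiding (Inl w) (subdivided (insert {w, snd B} (edges (fst B)))) =
    insert {Inl (snd B), Inr {w, snd B}} (subdivided (edges (fst B)))"
proof -
  have "w \<noteq> snd B" "\<And>e. e \<in> edges (fst B) \<Longrightarrow> w \<notin> e"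
    using assms by (auto simp: rooted_family_def)
  then show ?thesis
    unfolding subdivided_insert_pair by (auto simp: avoiding_def subdivided_def)
qed

lemma mpoly_subdivided_hang:
  assumes "rooted_family \<B>" "w \<notin> family_verts \<B>" "finite F" "{} \<notin> F"
    and "\<Union>F \<inter> shadow (family_verts \<B>) = {}" "x > 0"
  shows "mpoly x (F \<union> subdivided (hang w \<B>)) =
    (\<Prod>B\<in>\<B>. branch_weight x B) *
    (mpoly x F + (\<Sum>B\<in>\<B>. branch_share x B) * mpoly x (avoiding (Inl w) F))"
proof -
  have "finite \<B>" using assms(1) by (simp add: rooted_family_def)
  then show ?thesis using assms
  proof (induction \<B> arbitrary: F rule: finite_induct)
    case empty
    then show ?case by (simp add: hang_def subdivided_def)
  next
    case (insert B \<B>)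
    obtain H r where B: "B = (H, r)" by (cases B)
    define G where "G = subdivided (edges H)"
    let ?m = "Inr {w, r} :: 'a + 'a set"
    let ?P = "\<Prod>B\<in>\<B>. branch_weight x B" and ?A = "\<Sum>B\<in>\<B>. branch_share x B"
    \<comment> \<open>\<open>F\<close> after absorbing the branch \<open>B\<close>; the induction
      hypothesis is applied to this set.\<close>
    define F' where "F' = F \<union> subdivided (insert {w, r} (edges H))"
    have fam: "rooted_family \<B>" "rooted_family {B}" using insert.prems(1) rooted_family_subset by blast+
    have edges: "\<And>e. e \<in> edges H \<Longrightarrow> e \<subseteq> verts H" "r \<in> verts H"
      using insert.prems(1) by (auto simp: rooted_family_def B)
    have w: "w \<notin> verts H" "w \<notin> family_verts \<B>" using insert.prems(2) by (auto simp: family_verts_def B)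
    have disj: "verts H \<inter> family_verts \<B> = {}"
      using insert.prems(1) insert.hyps(2) unfolding rooted_family_def family_verts_def B by fastforce
    note facts = branch_facts[OF insert.prems(1) insertI1 insert.prems(6), unfolded B fst_conv snd_conv,
        folded G_def B]
    have FB: "\<Union>F \<inter> shadow (verts H) = {}" "\<Union>F \<inter> shadow (family_verts \<B>) = {}"
      using insert.prems(5) shadow_mono[of "verts H" "family_verts (insert B \<B>)"]
        shadow_mono[of "family_verts \<B>" "family_verts (insert B \<B>)"]
      by (fastforce simp: family_verts_def B)+
    have UG: "\<Union>G \<subseteq> shadow (verts H)"
      using edges(1) by (fastforce simp: G_def subdivided_def shadow_def)
    have sh: "Inl r \<in> shadow (verts H)" "?m \<in> shadow (verts H)"
      using edges(2) by (auto simp: shadow_def)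
    have mG: "?m \<notin> \<Union>G" "Inl w \<notin> \<Union>G"
      using edges(1) w(1) unfolding G_def Inr_in_subdivided Inl_in_subdivided by blast+
    have F'_eq: "F' = F \<union> insert {Inl w, ?m} (insert {Inl r, ?m} G)"
      by (simp add: F'_def subdivided_insert_pair G_def)
    have F'1: "mpoly x F' = branch_weight x B *
        (mpoly x F + branch_share x B * mpoly x (avoiding (Inl w) F))"
    proof -
      have "mpoly x F' = mpoly x F * branch_weight x B + x * mpoly x (avoiding (Inl w) F) * mpoly x G"
        unfolding F'_eq facts(2)
        using insert.prems facts(1) FB(1) UG sh mG w(1) edges(2) by (intro mpoly_hang) auto
      also have "x * mpoly x (avoiding (Inl w) F) * mpoly x G =
          branch_weight x B * branch_share x B * mpoly x (avoiding (Inl w) F)"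
        using facts(4) by simp
      finally show ?thesis by (simp add: algebra_simps)
    qed
    \<comment> \<open>Once \<open>Inl w\<close> is forbidden, the new branch contributes its weight
      but no share; hence no products of shares arise.\<close>
    have "avoiding (Inl w) F' = avoiding (Inl w) F \<union> insert {Inl r, ?m} G"
      unfolding F'_def avoiding_Un
      using avoiding_hanging_branch[OF fam(2), of w] w(1) by (simp add: B G_def)
    moreover have "\<Union>(avoiding (Inl w) F) \<inter> insert (Inl r) (insert ?m (\<Union>G)) = {}"
      using FB(1) UG sh Union_avoiding[of "Inl w" F] by blast
    ultimately have F'2: "mpoly x (avoiding (Inl w) F') =
        branch_weight x B * mpoly x (avoiding (Inl w) F)"
      using mpoly_hang_Un[of "avoiding (Inl w) F" G "Inl r" ?m x] insert.prems(3,4) facts(1,2) mG(1)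
        empty_in_avoiding[of F] by (simp add: mult.commute)
    have "mpoly x (F \<union> subdivided (hang w (insert B \<B>))) = mpoly x (F' \<union> subdivided (hang w \<B>))"
      unfolding F'_def hang_insert subdivided_Un B fst_conv snd_conv Un_assoc ..
    also have "\<dots> = ?P * (mpoly x F' + ?A * mpoly x (avoiding (Inl w) F'))"
    proof (rule insert.IH[OF fam(1) w(2)])
      show "finite F'" "{} \<notin> F'" using insert.prems facts(1) by (auto simp: F'_eq G_def)
      have "\<Union>(insert {w, r} (edges H)) \<inter> family_verts \<B> = {}"
        using edges w(2) disj by auto
      then have "\<Union>(subdivided (insert {w, r} (edges H))) \<inter> shadow (family_verts \<B>) = {}"
        by (rule subdivided_shadow_disjoint)
      then show "\<Union>F' \<inter> shadow (family_verts \<B>) = {}"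
        using FB(2) by (simp only: F'_def Union_Un_distrib Int_Un_distrib2 Un_empty)
    qed (rule insert.prems)
    also have "\<dots> = (\<Prod>B\<in>insert B \<B>. branch_weight x B) *
        (mpoly x F + (\<Sum>B\<in>insert B \<B>. branch_share x B) * mpoly x (avoiding (Inl w) F))"
      using insert.hyps by (simp add: F'1 F'2 algebra_simps)
    finally show ?case .
  qed
qed

text \<open>\<open>mpoly_subdivided_hang\<close> is applied at \<open>u\<close> to \<open>E\<close>
  with the branches at \<open>v\<close> already hung on it, and the two sums that arise are expanded
  by the same lemma at \<open>v\<close>. \<open>H\<close> enters through its edges only, so gluing
  has to be evaluated on edge sets alone.\<close>

lemma match_poly_hang_two:
  assumes "is_ugraph G" "u \<in> verts G" "v \<in> verts G" "u \<noteq> v" "x > 0"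
    and fam: "rooted_family (\<A> \<union> \<B>)" and dis: "\<A> \<inter> \<B> = {}"
    and out: "family_verts (\<A> \<union> \<B>) \<inter> verts G = {}"
    and edges: "edges H = edges G \<union> hang u \<A> \<union> hang v \<B>"
  defines "E \<equiv> subdivided (edges G)"
  shows "match_poly (subdivision H) x = (\<Prod>B\<in>\<A> \<union> \<B>. branch_weight x B) *
    (mpoly x E + (\<Sum>B\<in>\<A>. branch_share x B) * mpoly x (avoiding (Inl u) E) +
     (\<Sum>B\<in>\<B>. branch_share x B) * mpoly x (avoiding (Inl v) E) +
     (\<Sum>B\<in>\<A>. branch_share x B) * (\<Sum>B\<in>\<B>. branch_share x B) *
       mpoly x (avoiding (Inl u) (avoiding (Inl v) E)))"
proof -
  have famA: "rooted_family \<A>" and famB: "rooted_family \<B>"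
    using fam rooted_family_subset by blast+
  have fin: "finite \<A>" "finite \<B>" using famA famB by (auto simp: rooted_family_def)
  have outA: "verts G \<inter> family_verts \<A> = {}" and outB: "verts G \<inter> family_verts \<B> = {}"
    using out by (auto simp: family_verts_def)
  have AB: "family_verts \<A> \<inter> family_verts \<B> = {}"
  proof (rule equals0I)
    fix a assume "a \<in> family_verts \<A> \<inter> family_verts \<B>"
    then obtain A B where "A \<in> \<A>" "B \<in> \<B>" "a \<in> verts (fst A)" "a \<in> verts (fst B)"
      unfolding family_verts_def by blast
    moreover from this have "A \<noteq> B" using dis by blast
    ultimately show False using rooted_family_disjoint[OF fam, of A B] by blast
  qed
  have uv: "u \<notin> family_verts \<A>" "v \<notin> family_verts \<B>" "u \<notin> family_verts \<B>" "v \<notin> family_verts \<A>"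
    using assms(2,3) outA outB by blast+
  have sub: "e \<subseteq> verts G" if "e \<in> edges G" for e
    using assms(1) that by (simp add: is_ugraph_def)
  have finE: "finite E"
    using assms(1) unfolding E_def is_ugraph_def by (metis finite_edges_bounded(2))
  have E_A: "\<Union>E \<inter> shadow (family_verts \<A>) = {}" and E_B: "\<Union>E \<inter> shadow (family_verts \<B>) = {}"
    unfolding E_def using sub outA outB by (intro subdivided_shadow_disjoint; blast)+
  define F where "F = E \<union> subdivided (hang v \<B>)"
  have UB: "\<Union>(hang v \<B>) \<subseteq> insert v (family_verts \<B>)" using Union_hang_subset[OF famB] .
  then have "\<Union>(subdivided (hang v \<B>)) \<inter> shadow (family_verts \<A>) = {}"
    using AB uv by (intro subdivided_shadow_disjoint) blast
  then have F_A: "\<Union>F \<inter> shadow (family_verts \<A>) = {}"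
    using E_A by (simp only: F_def Union_Un_distrib Int_Un_distrib2 Un_empty)
  have finF: "finite F" using finE finite_subdivided_hang[OF famB] by (simp add: F_def)
  \<comment> \<open>As \<open>u\<close> differs from \<open>v\<close> and lies in no branch,
    forbidding it affects \<open>E\<close> alone.\<close>
  have "Inl u \<notin> \<Union>(subdivided (hang v \<B>))"
    unfolding Inl_in_subdivided using UB uv assms(4) by blast
  then have F_u: "avoiding (Inl u) F = avoiding (Inl u) E \<union> subdivided (hang v \<B>)"
    by (simp add: F_def avoiding_Un avoiding_trivial)
  have Eu_B: "\<Union>(avoiding (Inl u) E) \<inter> shadow (family_verts \<B>) = {}"
    using E_B Union_avoiding[of "Inl u" E] by blast
  have ne: "{} \<notin> E" "{} \<notin> F" by (simp_all add: E_def F_def)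
  have 1: "mpoly x F = (\<Prod>B\<in>\<B>. branch_weight x B) *
      (mpoly x E + (\<Sum>B\<in>\<B>. branch_share x B) * mpoly x (avoiding (Inl v) E))"
    unfolding F_def by (rule mpoly_subdivided_hang[OF famB uv(2) finE ne(1) E_B assms(5)])
  have 2: "mpoly x (avoiding (Inl u) F) = (\<Prod>B\<in>\<B>. branch_weight x B) *
      (mpoly x (avoiding (Inl u) E) +
       (\<Sum>B\<in>\<B>. branch_share x B) * mpoly x (avoiding (Inl v) (avoiding (Inl u) E)))"
    unfolding F_u using finE empty_in_avoiding[OF ne(1)]
    by (intro mpoly_subdivided_hang[OF famB uv(2) _ _ Eu_B assms(5)]) auto
  have "subdivided (edges H) = F \<union> subdivided (hang u \<A>)"
    unfolding edges F_def E_def subdivided_Un by (simp add: ac_simps)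
  moreover from this have "finite (subdivided (edges H))"
    using finF finite_subdivided_hang[OF famA] by simp
  ultimately have "match_poly (subdivision H) x = mpoly x (F \<union> subdivided (hang u \<A>))"
    by (simp add: match_poly_eq edges_subdivision)
  also have "\<dots> = (\<Prod>B\<in>\<A>. branch_weight x B) *
      (mpoly x F + (\<Sum>B\<in>\<A>. branch_share x B) * mpoly x (avoiding (Inl u) F))"
    by (rule mpoly_subdivided_hang[OF famA uv(1) finF ne(2) F_A assms(5)])
  finally show ?thesis
    unfolding 1 2 avoiding_commute[of "Inl v" "Inl u"] prod.union_disjoint[OF fin dis]
    by (simp add: algebra_simps)
qed

section \<open>Branches of a rooted tree\<close>

lemma adj_sym: "(a, b) \<in> (adj G)\<^sup>* \<Longrightarrow> (b, a) \<in> (adj G)\<^sup>*"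
  by (rule symD[OF sym_rtrancl]) (auto simp: adj_def sym_def insert_commute)

lemma adj_rtrancl_verts:
  assumes "(a, b) \<in> (adj G)\<^sup>*" "\<forall>e\<in>edges G. e \<subseteq> verts G" "a \<in> verts G"
  shows "b \<in> verts G"
  using assms(1,3) by (induction rule: rtrancl_induct) (use assms(2) in \<open>auto simp: adj_def\<close>)

text \<open>A walk is built from its end backwards and cut whenever a vertex recurs. Recording that
  all its vertices are reachable later shows that a path in \<open>delete_vertex T w\<close> misses
  \<open>w\<close>.\<close>

lemma distinct_path:
  assumes "(a, b) \<in> (adj G)\<^sup>*"
  shows "\<exists>p. p \<noteq> [] \<and> hd p = a \<and> last p = b \<and> distinct p \<and> set p \<subseteq> {c. (a, c) \<in> (adj G)\<^sup>*} \<and>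
    successively (\<lambda>y z. {y, z} \<in> edges G) p"
  using assms
proof (induction rule: converse_rtrancl_induct)
  case base
  show ?case by (intro exI[of _ "[b]"]) simp
next
  case (step a a')
  then obtain p where p: "p \<noteq> []" "hd p = a'" "last p = b" "distinct p"
    "set p \<subseteq> {c. (a', c) \<in> (adj G)\<^sup>*}" "successively (\<lambda>y z. {y, z} \<in> edges G) p"
    by blast
  have sub: "set p \<subseteq> {c. (a, c) \<in> (adj G)\<^sup>*}"
    using p(5) step.hyps(1) by (auto intro: converse_rtrancl_into_rtrancl)
  show ?case
  proof (cases "a \<in> set p")
    case True
    \<comment> \<open>The loop from \<open>a\<close> back to \<open>a\<close> is dropped; the suffix
      starting at \<open>a\<close> is kept.\<close>
    then obtain ys zs where "p = ys @ a # zs" by (meson split_list)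
    then show ?thesis using p sub
      by (intro exI[of _ "a # zs"]) (auto simp: successively_append_iff)
  next
    case False
    then show ?thesis using p sub step.hyps(1)
      by (intro exI[of _ "a # p"]) (auto simp: successively_Cons adj_def)
  qed
qed

text \<open>Connectedness gives every component of the tree minus \<open>w\<close> a neighbour of
  \<open>w\<close>, and acyclicity makes it unique; so the \<open>THE\<close> in
  \<open>branches\<close> denotes that vertex.\<close>

lemma has_branches_decompose:
  assumes "has_branches T w Bs"
  shows "rooted_family (set Bs)" "w \<notin> family_verts (set Bs)"
    and "verts T = insert w (family_verts (set Bs))" "edges T = hang w (set Bs)"
proof -
  define V E D where "V = verts T" and "E = edges T" and "D = delete_vertex T w"
  have w: "w \<in> V" and Bs: "set Bs = branches T w" and con: "connected_ugraph T"
    and cyc: "\<And>c. \<not> is_cycle T c" and fin: "finite V" and sub: "\<And>e. e \<in> E \<Longrightarrow> e \<subseteq> V \<and> card e = 2"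
    using assms by (auto simp: has_branches_def is_rooted_tree_def is_tree_def is_ugraph_def V_def E_def)
  have D: "verts D = V - {w}" "edges D = {e \<in> E. e \<subseteq> V - {w}}"
    by (auto simp: D_def delete_vertex_def induced_def V_def E_def)
  define K where "K a = {b \<in> V - {w}. (a, b) \<in> (adj D)\<^sup>*}" for a
  define \<rho> where "\<rho> a = (THE r. r \<in> K a \<and> {w, r} \<in> E)" for a
  have "induced D {b \<in> verts D. (a, b) \<in> (adj D)\<^sup>*} = (K a, {e \<in> E. e \<subseteq> K a})" for a
    by (auto simp: induced_def D K_def)
  then have "branches T w = (\<lambda>a. ((K a, {e \<in> E. e \<subseteq> K a}), \<rho> a)) ` (V - {w})"
    unfolding branches_def components_def D_def[symmetric] image_image
    by (simp add: \<rho>_def E_def D)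
  then have Bs: "set Bs = (\<lambda>a. ((K a, {e \<in> E. e \<subseteq> K a}), \<rho> a)) ` (V - {w})" using Bs by simp
  then have mem: "((K a, {e \<in> E. e \<subseteq> K a}), \<rho> a) \<in> set Bs" if "a \<in> V - {w}" for a
    using that by blast
  have K_self: "a \<in> K a" if "a \<in> V - {w}" for a using that by (simp add: K_def)
  have K_eq: "K b = K a" if "b \<in> K a" for a b
    using that by (auto simp: K_def dest: adj_sym intro: rtrancl_trans)
  \<comment> \<open>Along a walk from \<open>a\<close> to \<open>w\<close>, the last vertex before
    the first visit to \<open>w\<close> is still in the component of \<open>a\<close>.\<close>
  have ex: "\<exists>r. r \<in> K a \<and> {w, r} \<in> E" if a: "a \<in> V - {w}" for a
  proof -
    have "(a, w) \<in> (adj T)\<^sup>*" using con a w by (auto simp: connected_ugraph_def V_def)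
    then show ?thesis using a
    proof (induction rule: converse_rtrancl_induct)
      case (step a b)
      have e: "{a, b} \<in> E" using step.hyps(1) by (simp add: adj_def E_def)
      show ?case
      proof (cases "b = w")
        case True
        then show ?thesis using e step.prems K_self by (auto simp: insert_commute)
      next
        case False
        then have b: "b \<in> V - {w}" using e sub by auto
        then have "(a, b) \<in> adj D" using e step.prems by (auto simp: adj_def D)
        then have "b \<in> K a" using b by (auto simp: K_def)
        then show ?thesis using step.IH b K_eq by metis
      qed
    qed simp
  qed
  \<comment> \<open>Two neighbours of \<open>w\<close> in one component would close a cycle through
    \<open>w\<close>.\<close>
  have uniq: "r = s" if "r \<in> K a" "s \<in> K a" "{w, r} \<in> E" "{w, s} \<in> E" for a r s
  proof (rule ccontr)
    assume "r \<noteq> s"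
    have s: "s \<in> K r" using that K_eq by metis
    then obtain p where p: "p \<noteq> []" "hd p = r" "last p = s" "distinct p"
      "set p \<subseteq> {c. (r, c) \<in> (adj D)\<^sup>*}" "successively (\<lambda>y z. {y, z} \<in> edges D) p"
      using distinct_path[of r s D] by (auto simp: K_def)
    \<comment> \<open>The path runs inside \<open>D\<close>, hence misses \<open>w\<close>; with at
      least two vertices it gives a cycle of length at least three.\<close>
    have "r \<in> verts D" using that(1) by (simp add: K_def D)
    then have "w \<notin> set p" using p(5) adj_rtrancl_verts[of r w D] by (auto simp: D)
    moreover have "length p \<ge> 2"
      using p(1-3) \<open>r \<noteq> s\<close> by (cases p; cases "tl p") auto
    moreover have "{(w # p) ! i, (w # p) ! (Suc i mod length (w # p))} \<in> E" if i: "i < length (w # p)" for i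
    proof -
      \<comment> \<open>The edges of the cycle: from \<open>w\<close> to \<open>r\<close>, from
        \<open>s\<close> back to \<open>w\<close> by the wrap-around of the index, and those of
        \<open>p\<close>.\<close>
      consider "i = 0" | "i = length p" "i \<noteq> 0" | j where "i = Suc j" "Suc j < length p"
        using i by (cases i) fastforce+
      then show ?thesis
      proof cases
        case 1
        then show ?thesis using p(1,2) \<open>{w, r} \<in> E\<close> by (simp add: hd_conv_nth)
      next
        case 2
        then have "(w # p) ! i = s" using p(1,3) by (simp add: last_conv_nth nth_Cons')
        moreover have "(w # p) ! (Suc i mod length (w # p)) = w" using 2 by simp
        ultimately show ?thesis using \<open>{w, s} \<in> E\<close> by (simp only: insert_commute)
      next
        case 3
        then show ?thesis using p(6) by (auto simp: successively_conv_nth D)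
      qed
    qed
    ultimately have "is_cycle T (w # p)" using p(4) unfolding is_cycle_def E_def by auto
    then show False using cyc by blast
  qed
  have \<rho>: "\<rho> a \<in> K a \<and> {w, \<rho> a} \<in> E" if "a \<in> V - {w}" for a
  proof -
    have "\<exists>!r. r \<in> K a \<and> {w, r} \<in> E"
    proof (rule ex_ex1I[OF ex[OF that]])
      fix r s assume "r \<in> K a \<and> {w, r} \<in> E" "s \<in> K a \<and> {w, s} \<in> E"
      then show "r = s" using uniq[of r a s] by simp
    qed
    then show ?thesis unfolding \<rho>_def by (rule theI')
  qed
  have \<rho>_eq: "\<rho> a = a" if "a \<in> V - {w}" "{w, a} \<in> E" for a
    using \<rho>[OF that(1)] K_self[OF that(1)] that(2) uniq[of "\<rho> a" a a] by simp
  have fv: "family_verts (set Bs) = V - {w}"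
    unfolding Bs family_verts_def using K_self by (auto simp: K_def)
  then show "w \<notin> family_verts (set Bs)" "verts T = insert w (family_verts (set Bs))"
    using w by (auto simp: V_def)
  \<comment> \<open>A branch is recovered from any of its vertices, so branches sharing a vertex
    coincide.\<close>
  have same: "B = ((K c, {e \<in> E. e \<subseteq> K c}), \<rho> c)" if B: "B \<in> set Bs" and c: "c \<in> verts (fst B)" for B c
  proof -
    obtain a where a: "B = ((K a, {e \<in> E. e \<subseteq> K a}), \<rho> a)" using B by (auto simp: Bs)
    then have "K c = K a" using K_eq c by simp
    then show ?thesis by (simp add: a \<rho>_def)
  qed
  have "verts (fst B) \<inter> verts (fst C) = {}" if "B \<in> set Bs" "C \<in> set Bs" "B \<noteq> C" for B C
  proof (rule equals0I)
    fix c assume "c \<in> verts (fst B) \<inter> verts (fst C)"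
    then have "B = C" using trans[OF same[OF that(1)] same[OF that(2), symmetric]] by blast
    then show False using that(3) by simp
  qed
  moreover have "finite (verts (fst B)) \<and> (\<forall>e\<in>edges (fst B). e \<subseteq> verts (fst B)) \<and> snd B \<in> verts (fst B)"
    if "B \<in> set Bs" for B
  proof -
    obtain a where a: "a \<in> V - {w}" "B = ((K a, {e \<in> E. e \<subseteq> K a}), \<rho> a)" using \<open>B \<in> set Bs\<close> by (auto simp: Bs)
    have "finite (K a)" using fin by (simp add: K_def)
    then show ?thesis using \<rho>[OF a(1)] by (simp add: a(2))
  qed
  ultimately show "rooted_family (set Bs)" unfolding rooted_family_def by blast
  \<comment> \<open>An edge at \<open>w\<close> leads to the root of a branch; any other edge stays
    inside one component.\<close>
  show "edges T = hang w (set Bs)"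
  proof (intro equalityI subsetI)
    fix e assume "e \<in> edges T"
    then have e: "e \<in> E" by (simp add: E_def)
    then obtain a b where ab: "e = {a, b}" "a \<noteq> b" using sub by (meson card_2_iff)
    show "e \<in> hang w (set Bs)"
    proof (cases "w \<in> e")
      case True
      then obtain c where c: "e = {w, c}" "c \<noteq> w" using ab by auto
      then have cV: "c \<in> V - {w}" using sub[OF e] by auto
      then have "\<rho> c = c" using \<rho>_eq e c(1) by simp
      then show ?thesis using mem[OF cV] c(1) by (intro mem_hangI[where B = "((K c, {e \<in> E. e \<subseteq> K c}), \<rho> c)"]) simp_all
    next
      case False
      then have ab': "a \<in> V - {w}" "b \<in> V - {w}" using sub[OF e] ab by auto
      then have "(a, b) \<in> adj D" using e ab by (simp add: adj_def D)
      then have "e \<subseteq> K a" using ab ab' by (auto simp: K_def)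
      then show ?thesis using mem[OF ab'(1)] e
        by (intro mem_hangI[where B = "((K a, {e \<in> E. e \<subseteq> K a}), \<rho> a)"]) simp_all
    qed
  next
    fix e assume "e \<in> hang w (set Bs)"
    then obtain a where a: "a \<in> V - {w}" "e = {w, \<rho> a} \<or> e \<in> {e \<in> E. e \<subseteq> K a}"
      unfolding hang_def Bs by auto
    then show "e \<in> edges T" using \<rho>[OF a(1)] by (auto simp: E_def)
  qed
qed

section \<open>The edge set of the glued tree\<close>

lemma edges_identify: "edges (identify w u G) = (\<lambda>e. (\<lambda>y. if y = w then u else y) ` e) ` edges G"
  by (simp add: identify_def map_ugraph_def)

lemma rename_trivial: "w \<notin> \<Union>E \<Longrightarrow> (\<lambda>e. (\<lambda>y. if y = w then u else y) ` e) ` E = E"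
proof -
  assume "w \<notin> \<Union>E"
  then have "(\<lambda>y. if y = w then u else y) ` e = e" if "e \<in> E" for e
    using that by (auto simp: image_def split: if_splits)
  then show ?thesis by simp
qed

text \<open>Since \<open>w\<close> lies in no branch, the renaming changes only the joining
  edges.\<close>

lemma rename_hang:
  assumes "rooted_family \<B>" "w \<notin> family_verts \<B>"
  shows "(\<lambda>e. (\<lambda>y. if y = w then u else y) ` e) ` hang w \<B> = hang u \<B>"
proof -
  have *: "w \<notin> \<Union>(edges (fst B))" "w \<noteq> snd B" if "B \<in> \<B>" for B
  proof -
    have "w \<notin> verts (fst B)" using assms(2) that by (auto simp: family_verts_def)
    moreover have "\<forall>e\<in>edges (fst B). e \<subseteq> verts (fst B)" "snd B \<in> verts (fst B)"
      using assms(1) that by (auto simp: rooted_family_def)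
    ultimately show "w \<notin> \<Union>(edges (fst B))" "w \<noteq> snd B" by blast+
  qed
  have "(\<lambda>e. (\<lambda>y. if y = w then u else y) ` e) ` insert {w, snd B} (edges (fst B)) =
      insert {u, snd B} (edges (fst B))" if "B \<in> \<B>" for B
  proof -
    have "(\<lambda>y. if y = w then u else y) ` {w, snd B} = {u, snd B}" using *(2)[OF that] by auto
    then show ?thesis by (simp only: image_insert[of _ "{w, snd B}"] rename_trivial[OF *(1)[OF that]])
  qed
  then show ?thesis unfolding hang_def image_UN by (rule SUP_cong[OF refl])
qed

text \<open>The inner renaming must spare \<open>T0\<close> and \<open>T1\<close>, and the outer one
  must spare \<open>T0\<close> and the branches already moved to \<open>v\<close>. The freshness
  conditions on \<open>v1\<close> and \<open>v2\<close> ensure this.\<close>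

lemma edges_attach:
  assumes "rooted_family \<A>" "rooted_family \<B>" "edges T1 = hang v1 \<A>" "edges T2 = hang v2 \<B>"
    and "\<And>e. e \<in> edges T0 \<Longrightarrow> e \<subseteq> verts T0" "v \<in> verts T0"
    and "v1 \<notin> verts T0 \<union> family_verts (\<A> \<union> \<B>)" "v2 \<notin> verts T0 \<union> family_verts (\<A> \<union> \<B>)" "v1 \<noteq> v2"
  shows "edges (attach T0 u v T1 v1 T2 v2) = edges T0 \<union> hang u \<A> \<union> hang v \<B>"
proof -
  have U: "\<Union>(hang v1 \<A>) \<subseteq> insert v1 (family_verts \<A>)" "\<Union>(hang v \<B>) \<subseteq> insert v (family_verts \<B>)"
    by (rule Union_hang_subset[OF assms(1)], rule Union_hang_subset[OF assms(2)])
  have n: "v1 \<notin> family_verts \<A>" "v2 \<notin> family_verts \<A>" "v1 \<notin> family_verts \<B>" "v2 \<notin> family_verts \<B>"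
    using assms(7,8) by (auto simp: family_verts_def)
  have "v2 \<notin> \<Union>(edges T0)" "v1 \<notin> \<Union>(edges T0)" "v2 \<notin> \<Union>(hang v1 \<A>)" "v1 \<notin> \<Union>(hang v \<B>)"
  proof -
    have "\<Union>(edges T0) \<subseteq> verts T0" using assms(5) by blast
    then show "v2 \<notin> \<Union>(edges T0)" "v1 \<notin> \<Union>(edges T0)" using assms(7,8) by auto
    show "v2 \<notin> \<Union>(hang v1 \<A>)" using U(1) n(2) assms(9) by auto
    show "v1 \<notin> \<Union>(hang v \<B>)" using U(2) n(3) assms(6,7) by auto
  qed
  then show ?thesis
    unfolding attach_def edges_identify union_ugraph_def fst_conv snd_conv assms(3,4)
    by (simp only: image_Un rename_trivial rename_hang[OF assms(1) n(1)] rename_hang[OF assms(2) n(4)]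
        Un_assoc not_False_eq_True)
qed

section \<open>Redistributing the branches\<close>

text \<open>With \<open>c\<close> the minimum of \<open>f\<close> on \<open>B\<close>,
  \<open>sum f A\<close> is at most \<open>card A\<close> times \<open>c\<close>, which is at most
  \<open>card B\<close> times \<open>c\<close>, which is at most \<open>sum f B\<close>. Equality at
  the ends forces it throughout, and \<open>c > 0\<close> then gives equal cardinalities.\<close>

lemma sum_le_sum_separated:
  fixes f :: "'b \<Rightarrow> real"
  assumes "finite A" "finite B" "card A \<le> card B" "\<And>a b. a \<in> A \<Longrightarrow> b \<in> B \<Longrightarrow> f a \<le> f b"
    and "\<And>b. b \<in> B \<Longrightarrow> f b > 0"
  shows "sum f A \<le> sum f B"
    and "sum f A = sum f B \<Longrightarrow> card A = card B \<and> (\<forall>a\<in>A. \<forall>b\<in>B. f a = f b)"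
proof -
  have "sum f A \<le> sum f B \<and> (sum f A = sum f B \<longrightarrow> card A = card B \<and> (\<forall>a\<in>A. \<forall>b\<in>B. f a = f b))"
  proof (cases "B = {}")
    case True
    then show ?thesis using assms by simp
  next
    case False
    define c where "c = Min (f ` B)"
    have c: "c > 0" "\<And>b. b \<in> B \<Longrightarrow> c \<le> f b" "\<And>a. a \<in> A \<Longrightarrow> f a \<le> c"
      using False assms by (auto simp: c_def)
    have 1: "real (card A) * c - sum f A = (\<Sum>a\<in>A. c - f a)" by (simp add: sum_subtractf)
    have 2: "sum f B - real (card B) * c = (\<Sum>b\<in>B. f b - c)" by (simp add: sum_subtractf)
    have 3: "(\<Sum>a\<in>A. c - f a) \<ge> 0" "(\<Sum>b\<in>B. f b - c) \<ge> 0" using c by (auto intro: sum_nonneg)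
    have 4: "real (card A) * c \<le> real (card B) * c" using assms(3) c(1) by simp
    show ?thesis
    proof (intro conjI impI)
      show "sum f A \<le> sum f B" using 1 2 3 4 by linarith
      assume "sum f A = sum f B"
      then have z: "real (card A) * c = real (card B) * c" "(\<Sum>a\<in>A. c - f a) = 0" "(\<Sum>b\<in>B. f b - c) = 0"
        using 1 2 3 4 by linarith+
      then show "card A = card B" using c(1) by simp
      have "\<forall>a\<in>A. c - f a = 0" "\<forall>b\<in>B. f b - c = 0"
        using z(2,3) c assms(1,2) by (simp_all add: sum_nonneg_eq_0_iff)
      then show "\<forall>a\<in>A. \<forall>b\<in>B. f a = f b" by simp
    qed
  qed
  then show "sum f A \<le> sum f B"
    "sum f A = sum f B \<Longrightarrow> card A = card B \<and> (\<forall>a\<in>A. \<forall>b\<in>B. f a = f b)" by blast+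
qed

text \<open>The part \<open>X \<inter> P\<close> cancels, and \<open>P - X\<close> is compared with
  \<open>X - P\<close>, whose values are no smaller because they lie in \<open>Q\<close>. Equality
  means that \<open>X\<close> is itself a choice of smallest values.\<close>

lemma sum_smallest:
  fixes f :: "'b \<Rightarrow> real"
  assumes "finite (X \<union> Y)" "X \<union> Y = P \<union> Q" "X \<inter> Y = {}" "P \<inter> Q = {}" "card P \<le> card X"
    and le: "\<And>p q. p \<in> P \<Longrightarrow> q \<in> Q \<Longrightarrow> f p \<le> f q" and pos: "\<And>z. z \<in> X \<union> Y \<Longrightarrow> f z > 0"
  shows "sum f P \<le> sum f X"
    and "sum f P = sum f X \<longleftrightarrow> card P = card X \<and> (\<forall>a\<in>X. \<forall>b\<in>Y. f a \<le> f b)"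
proof -
  have fin: "finite X" "finite P" using assms(1,2) by (metis finite_Un)+
  have s: "sum f X = sum f (X \<inter> P) + sum f (X - P)" "sum f P = sum f (X \<inter> P) + sum f (P - X)"
    "card X = card (X \<inter> P) + card (X - P)" "card P = card (X \<inter> P) + card (P - X)"
    using fin by (metis sum.Int_Diff card_Int_Diff Int_commute)+
  have sub: "X - P \<subseteq> Q" "P - X \<subseteq> Y" using assms(2) by blast+
  have sep: "f a \<le> f b" if "a \<in> P - X" "b \<in> X - P" for a b using that le sub by blast
  have c: "card (P - X) \<le> card (X - P)" using assms(5) s(3,4) by linarith
  note sums = sum_le_sum_separated[of "P - X" "X - P" f, OF _ _ c sep]
  show "sum f P \<le> sum f X" using sums(1) s fin pos by simp
  show "sum f P = sum f X \<longleftrightarrow> card P = card X \<and> (\<forall>a\<in>X. \<forall>b\<in>Y. f a \<le> f b)"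
  proof
    assume "sum f P = sum f X"
    then have "sum f (P - X) = sum f (X - P)" using s by simp
    then have eq: "card (P - X) = card (X - P)" "\<And>a b. a \<in> P - X \<Longrightarrow> b \<in> X - P \<Longrightarrow> f a = f b"
      using sums(2) fin pos by auto
    \<comment> \<open>\<open>f a\<close> is bounded by a value on \<open>P\<close> and
      \<open>f b\<close> from below by a value on \<open>Q\<close>; outside \<open>P\<close> or
      \<open>Q\<close> such values come from the equalities across the two differences.\<close>
    have "f a \<le> f b" if a: "a \<in> X" and b: "b \<in> Y" for a b
    proof -
      have "\<exists>p\<in>P. f a \<le> f p"
      proof (cases "a \<in> P")
        case False
        then have "P - X \<noteq> {}" using eq(1) a fin by (metis DiffI card_0_eq card.empty empty_iff finite_Diff)
        then show ?thesis using eq(2) a False by fastforce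
      qed auto
      moreover have "\<exists>q\<in>Q. f q \<le> f b"
      proof (cases "b \<in> Q")
        case False
        then have bP: "b \<in> P - X" using b assms(2,3) by blast
        then have "X - P \<noteq> {}" using eq(1) fin by (metis card_0_eq card.empty empty_iff finite_Diff)
        then show ?thesis using eq(2) bP sub(1) by fastforce
      qed auto
      ultimately show ?thesis using le by (meson order_trans)
    qed
    then show "card P = card X \<and> (\<forall>a\<in>X. \<forall>b\<in>Y. f a \<le> f b)" using s eq(1) by simp
  next
    assume r: "card P = card X \<and> (\<forall>a\<in>X. \<forall>b\<in>Y. f a \<le> f b)"
    \<comment> \<open>Here the roles are exchanged: \<open>X - P\<close> lies in \<open>X\<close>
      and \<open>P - X\<close> in \<open>Y\<close>.\<close>
    have "sum f (X - P) \<le> sum f (P - X)"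
      by (rule sum_le_sum_separated(1)) (use r s fin pos assms(2) sub in auto)
    then show "sum f P = sum f X" using sums(1) s fin pos by fastforce
  qed
qed

lemma max_le_min_iff:
  "finite A \<Longrightarrow> finite B \<Longrightarrow> max_le_min A B \<longleftrightarrow> (\<forall>a\<in>A. \<forall>b\<in>B. a \<le> b)"
  by (cases "A = {}"; cases "B = {}") (auto simp: max_le_min_def)

text \<open>The equality criterion is guarded because of degenerate cases. If \<open>Ls\<close> is
  empty and \<open>length Rs < d\<close>, the polynomials agree although neither alternative holds;
  likewise if \<open>Rs\<close> is empty, \<open>length Ls < d\<close> and the two polynomials of
  \<open>T0\<close> agree.\<close>

theorem theorem2p5:
  fixes x :: real
    and T0 T1 T2 T1' T2' T T' :: "'a ugraph"
    and u v v1 v2 :: 'a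
    and Ls Rs Ls' Rs' :: "'a rooted_ugraph list"
    and d :: nat
  defines "t \<equiv> \<lambda>B :: 'a rooted_ugraph. tau (rooted_subdivision B) x"
  assumes "x > 0"
    and "has_branches T1 v1 Ls"
    and "has_branches T2 v2 Rs"
    and "is_tree T0" and "u \<in> verts T0" and "v \<in> verts T0" and "u \<noteq> v"
    and "verts T0 \<inter> verts T1 = {}" and "verts T0 \<inter> verts T2 = {}"
    and "verts T1 \<inter> verts T2 = {}"
    and "T = attach T0 u v T1 v1 T2 v2"
    and "d > 0" and "d \<ge> max (length Ls) (length Rs)"
    and "length Ls + length Rs > d \<Longrightarrow>
           mset (Ls' @ Rs') = mset (Ls @ Rs) \<and>
           length Ls' = length Ls + length Rs - d \<and> length Rs' = d \<and>
           sorted_wrt (\<ge>) (map t (Ls' @ Rs')) \<and>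
           has_branches T1' v1 Ls' \<and> has_branches T2' v2 Rs'"
    and "length Ls + length Rs \<le> d \<Longrightarrow>
           T1' = ({v1}, {}) \<and>
           mset Rs' = mset (Ls @ Rs) \<and> has_branches T2' v2 Rs'"
    and "T' = attach T0 u v T1' v1 T2' v2"
    and "match_poly_10 (subdivision T0) (Inl u) (Inl v) x \<le> match_poly_01 (subdivision T0) (Inl u) (Inl v) x"
  shows "match_poly (subdivision T) x \<ge> match_poly (subdivision T') x \<and>
    ((Ls \<noteq> [] \<and> Rs \<noteq> []) \<or> length Ls + length Rs \<ge> d \<longrightarrow>
      (match_poly (subdivision T) x = match_poly (subdivision T') x \<longleftrightarrow>
        (length Rs = d \<and> max_le_min (t ` set Rs) (t ` set Ls)) \<or>
        (match_poly_10 (subdivision T0) (Inl u) (Inl v) x = match_poly_01 (subdivision T0) (Inl u) (Inl v) x \<and>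
         length Ls = d \<and> max_le_min (t ` set Ls) (t ` set Rs))))"
proof -
  \<comment> \<open>Unites the two cases of the construction: the empty list stands for the single
    vertex \<open>v1\<close>, and truncated subtraction gives its length in both cases.\<close>
  define Ls2 where "Ls2 = (if length Ls + length Rs > d then Ls' else [])"
  define E where "E = subdivided (edges T0)"
  define m00 where "m00 = mpoly x (avoiding (Inl u) (avoiding (Inl v) E))"
  define m10 where "m10 = match_poly_10 (subdivision T0) (Inl u) (Inl v) x"
  define m01 where "m01 = match_poly_01 (subdivision T0) (Inl u) (Inl v) x"
  \<comment> \<open>Depends only on the union of the branches, hence is common to \<open>T\<close>
    and \<open>T'\<close>.\<close>
  define W where "W = (\<Prod>B\<in>set Ls \<union> set Rs. branch_weight x B)"
  define S where "S Bs = (\<Sum>B\<in>set Bs. branch_share x B)" for Bs :: "'a rooted_ugraph list"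
  let ?U = "set Ls \<union> set Rs"
  note hyp = assms(2-)
  have x: "x > 0" by (rule hyp(1))
  note L = has_branches_decompose[OF hyp(2)] and R = has_branches_decompose[OF hyp(3)]
  have dL: "distinct Ls" and dR: "distinct Rs" using hyp(2,3) by (simp_all add: has_branches_def)
  have G: "is_ugraph T0" using hyp(4) by (simp add: is_tree_def)
  have sub0: "e \<subseteq> verts T0" if "e \<in> edges T0" for e using G that by (simp add: is_ugraph_def)

  \<comment> \<open>Disjointness of the branches and the edge sets of both trees\<close>
  have inL: "verts (fst B) \<subseteq> verts T1" if "B \<in> set Ls" for B
    using that unfolding L(3) family_verts_def by blast
  have inR: "verts (fst B) \<subseteq> verts T2" if "B \<in> set Rs" for B
    using that unfolding R(3) family_verts_def by blast
  have LR: "verts (fst B) \<inter> verts (fst C) = {}" if "B \<in> set Ls" "C \<in> set Rs" for B C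
    using inL[OF that(1)] inR[OF that(2)] hyp(10) by blast
  \<comment> \<open>Turns disjointness of vertex sets into disjointness of the two sets of
    branches.\<close>
  have ne: "verts (fst B) \<noteq> {}" if "B \<in> set Ls" for B
    using L(1) that unfolding rooted_family_def by blast
  have dis: "set Ls \<inter> set Rs = {}"
    using LR ne by fastforce
  have fam: "rooted_family ?U"
    using L(1) R(1) LR unfolding rooted_family_def
    by (simp add: ball_Un Int_commute) (metis Int_commute)
  have fv: "family_verts ?U = family_verts (set Ls) \<union> family_verts (set Rs)"
    by (simp add: family_verts_def)
  have out: "family_verts ?U \<inter> verts T0 = {}"
    using hyp(8,9) unfolding fv L(3) R(3) by blast
  have v12: "v1 \<notin> verts T0 \<union> family_verts ?U" "v2 \<notin> verts T0 \<union> family_verts ?U" "v1 \<noteq> v2"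
    using hyp(8-10) L(2) R(2) unfolding fv L(3) R(3) by blast+

  have mset: "mset (Ls2 @ Rs') = mset (Ls @ Rs)" and len: "length Ls2 = length Ls + length Rs - d"
    using hyp(14,15) by (auto simp: Ls2_def)
  have U: "set Ls2 \<union> set Rs' = ?U" using mset_eq_setD[OF mset] by simp
  have "distinct (Ls2 @ Rs')"
    using mset_eq_imp_distinct_iff[OF mset] dL dR dis by simp
  then have dis': "distinct Ls2" "distinct Rs'" "set Ls2 \<inter> set Rs' = {}" by simp_all
  have famL': "rooted_family (set Ls2)" and famR': "rooted_family (set Rs')"
    using fam U rooted_family_subset by (metis Un_upper1, metis Un_upper2)
  have e1: "edges T1' = hang v1 (set Ls2)"
  proof (cases "length Ls + length Rs > d")
    case True
    then have "has_branches T1' v1 Ls'" using hyp(14) by blast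
    then show ?thesis using True by (simp add: Ls2_def has_branches_decompose(4))
  next
    case False
    then show ?thesis using hyp(15) by (simp add: Ls2_def hang_def)
  qed
  have "has_branches T2' v2 Rs'" using hyp(14,15) by (meson not_le)
  then have e2: "edges T2' = hang v2 (set Rs')" by (rule has_branches_decompose(4))

  have edges_T: "edges T = edges T0 \<union> hang u (set Ls) \<union> hang v (set Rs)"
    unfolding hyp(11) by (rule edges_attach[OF L(1) R(1) L(4) R(4) sub0 hyp(6) v12])
  have edges_T': "edges T' = edges T0 \<union> hang u (set Ls2) \<union> hang v (set Rs')"
    unfolding hyp(16) by (rule edges_attach[OF famL' famR' e1 e2 sub0 hyp(6) v12[folded U]])

  \<comment> \<open>The difference of the two polynomials in factored form\<close>
  have finE: "finite E"
    using G unfolding E_def is_ugraph_def by (metis finite_edges_bounded(2))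
  have m00: "m00 > 0" unfolding m00_def by (intro mpoly_pos finite_avoiding finE x)
  have m: "mpoly x (avoiding (Inl v) E) = m00 + m10" "mpoly x (avoiding (Inl u) E) = m00 + m01"
    using finE unfolding m10_def m01_def m00_def match_poly_01_eq_10
    by (simp_all add: match_poly_10_eq edges_subdivision E_def avoiding_commute)
  have M: "match_poly (subdivision T) x =
      W * (mpoly x E + S Ls * (m00 + m01) + S Rs * (m00 + m10) + S Ls * S Rs * m00)"
    using match_poly_hang_two[OF G hyp(5-7) x fam dis out edges_T]
    unfolding E_def[symmetric] m W_def S_def m00_def by simp
  have M': "match_poly (subdivision T') x =
      W * (mpoly x E + S Ls2 * (m00 + m01) + S Rs' * (m00 + m10) + S Ls2 * S Rs' * m00)"
    using match_poly_hang_two[OF G hyp(5-7) x fam[folded U] dis'(3) out[folded U] edges_T']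
    unfolding E_def[symmetric] m W_def S_def m00_def U by simp
  have "S Ls + S Rs = sum (branch_share x) ?U"
    using dis by (simp add: S_def sum.union_disjoint)
  also have "\<dots> = S Ls2 + S Rs'"
    unfolding U[symmetric] using dis'(3) by (simp add: S_def sum.union_disjoint)
  finally have SR: "S Rs' = S Ls + S Rs - S Ls2" by simp
  \<comment> \<open>Eliminating \<open>S Rs'\<close> through the conserved total cancels
    \<open>mpoly x E\<close> and exposes the factor \<open>S Ls - S Ls2\<close>.\<close>
  have diff: "match_poly (subdivision T) x - match_poly (subdivision T') x =
      W * ((S Ls - S Ls2) * (m00 * (S Rs - S Ls2) + (m01 - m10)))"
    unfolding M M' SR by (simp add: algebra_simps)

  \<comment> \<open>Signs of the factors and the case of equality\<close>
  note facts = branch_facts[OF fam _ x]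
  have W: "W > 0" unfolding W_def using facts(3) by (intro prod_pos) auto
  \<comment> \<open>Shares decrease as \<tau> grows, so the branches with the largest \<tau> have
    the smallest shares.\<close>
  have share_le: "branch_share x B \<le> branch_share x C \<longleftrightarrow> t C \<le> t B" if "B \<in> ?U" "C \<in> ?U" for B C
  proof -
    have "1 + x * t B > 0" "1 + x * t C > 0"
      using facts(5) that x by (simp_all add: t_def add_pos_pos)
    moreover have "branch_share x B = x / (1 + x * t B)" "branch_share x C = x / (1 + x * t C)"
      using facts(6) that by (simp_all add: t_def)
    ultimately show ?thesis
      using x by (simp add: divide_inverse mult_le_cancel_left_pos)
  qed
  have share_pos: "branch_share x B > 0" if "B \<in> ?U" for B
    using facts(5,6)[OF that] x by (simp add: add_pos_pos)
  \<comment> \<open>Vacuous if \<open>Ls2\<close> is empty; otherwise the sorting hypothesis is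
    available.\<close>
  have sep: "branch_share x B \<le> branch_share x C" if BC: "B \<in> set Ls2" "C \<in> set Rs'" for B C
  proof -
    have "length Ls + length Rs > d" using BC(1) by (auto simp: Ls2_def split: if_splits)
    then have "sorted_wrt (\<ge>) (map t (Ls2 @ Rs'))" using hyp(14) by (simp add: Ls2_def)
    then have "t C \<le> t B" using BC by (auto simp: sorted_wrt_append)
    then show ?thesis using share_le BC U by blast
  qed
  have le_iff: "(\<forall>a\<in>set As. \<forall>b\<in>set Bs. branch_share x a \<le> branch_share x b) \<longleftrightarrow>
      max_le_min (t ` set Bs) (t ` set As)" if "set As \<subseteq> ?U" "set Bs \<subseteq> ?U" for As Bs
  proof -
    have "branch_share x a \<le> branch_share x b \<longleftrightarrow> t b \<le> t a" if "a \<in> set As" "b \<in> set Bs" for a b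
      using share_le[of a b] that \<open>set As \<subseteq> ?U\<close> \<open>set Bs \<subseteq> ?U\<close> by blast
    then have "(\<forall>a\<in>set As. \<forall>b\<in>set Bs. branch_share x a \<le> branch_share x b) \<longleftrightarrow>
        (\<forall>b\<in>set Bs. \<forall>a\<in>set As. t b \<le> t a)" by blast
    then show ?thesis by (simp add: max_le_min_iff)
  qed
  have finU: "finite (set Ls \<union> set Rs)" "finite (set Rs \<union> set Ls)" by simp_all
  have U2: "set Rs \<union> set Ls = set Ls2 \<union> set Rs'" "set Rs \<inter> set Ls = {}" using U dis by blast+
  have cards: "card (set Ls2) = length Ls2" "card (set Ls) = length Ls" "card (set Rs) = length Rs"
    using dis'(1) dL dR by (simp_all add: distinct_card)
  have k: "length Ls2 \<le> length Ls" "length Ls2 \<le> length Rs" using len hyp(13) by auto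
  \<comment> \<open>\<open>sum_smallest\<close> is used twice, comparing \<open>Ls2\<close> with
    \<open>Ls\<close> and then with \<open>Rs\<close>; this yields the two alternatives of the
    equality criterion.\<close>
  have A: "S Ls2 \<le> S Ls"
    "S Ls2 = S Ls \<longleftrightarrow> length Ls2 = length Ls \<and> max_le_min (t ` set Rs) (t ` set Ls)"
    using sum_smallest[of _ _ _ _ "branch_share x", OF finU(1) U[symmetric] dis dis'(3) _ sep share_pos] k(1)
    by (simp_all add: S_def cards le_iff)
  have B: "S Ls2 \<le> S Rs"
    "S Ls2 = S Rs \<longleftrightarrow> length Ls2 = length Rs \<and> max_le_min (t ` set Ls) (t ` set Rs)"
    using sum_smallest[of _ _ _ _ "branch_share x", OF finU(2) U2 dis'(3) _ sep] share_pos k(2)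
    by (simp_all add: S_def cards le_iff Un_commute)
  have m_le: "m10 \<le> m01" using hyp(17) by (simp add: m10_def m01_def)
  have P: "m00 * (S Rs - S Ls2) \<ge> 0" using m00 B(1) by simp
  have "match_poly (subdivision T) x - match_poly (subdivision T') x \<ge> 0"
    unfolding diff using W A(1) P m_le by simp
  moreover have "match_poly (subdivision T) x = match_poly (subdivision T') x \<longleftrightarrow>
      S Ls2 = S Ls \<or> (m10 = m01 \<and> S Ls2 = S Rs)"
  proof -
    have "match_poly (subdivision T) x = match_poly (subdivision T') x \<longleftrightarrow>
        (S Ls - S Ls2) * (m00 * (S Rs - S Ls2) + (m01 - m10)) = 0"
      using diff W by (metis eq_iff_diff_eq_0 less_irrefl mult_eq_0_iff)
    also have "\<dots> \<longleftrightarrow> S Ls2 = S Ls \<or> (m10 = m01 \<and> m00 * (S Rs - S Ls2) = 0)"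
    proof -
      \<comment> \<open>Both summands are nonnegative, so the second factor vanishes only if each of
        them does.\<close>
      have "m00 * (S Rs - S Ls2) + (m01 - m10) = 0 \<longleftrightarrow> m00 * (S Rs - S Ls2) = 0 \<and> m01 - m10 = 0"
        using P m_le by (intro add_nonneg_eq_0_iff) simp_all
      then show ?thesis by auto
    qed
    finally show ?thesis using m00 by auto
  qed
  \<comment> \<open>If the total is below \<open>d\<close>, truncation makes \<open>Ls2\<close>
    empty; the guard then makes \<open>Ls\<close> and \<open>Rs\<close> nonempty, and all four
    equations fail.\<close>
  moreover have "length Ls2 = length Ls \<longleftrightarrow> length Rs = d" "length Ls2 = length Rs \<longleftrightarrow> length Ls = d"
    if "(Ls \<noteq> [] \<and> Rs \<noteq> []) \<or> length Ls + length Rs \<ge> d"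
    using that len hyp(12,13) by (auto simp flip: length_greater_0_conv)
  ultimately show ?thesis
    unfolding A(2) B(2) m10_def m01_def by auto
qed

end
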